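(* Each continuous image of a space $K\in\mathcal{EC}_2$ belongs to $\mathcal{EC}_3$.
   Context: All topological spaces (in particular, continuous images) are assumed to be Tikhonov (completely regular Hausdorff). For a set $\Gamma$ and $n\in\omega$, $\sigma_n(\Gamma)$ denotes the subspace of the product $2^\Gamma$ (with $2=\{0,1\}$ discrete) consisting of all characteristic functions of subsets of $\Gamma$ of cardinality $\le n$. A compact space $K$ belongs to the class $\mathcal{EC}_n$ if $K$ can be (homeomorphically) embedded in $\sigma_n(\Gamma)$ for some set $\Gamma$. *)

theory Defs
  imports "HOL-Analysis.Analysis"
begin

definition tikhonov_space :: "'a topology \<Rightarrow> bool" where
  "tikhonov_space X \<longleftrightarrow> completely_regular_space X \<and> Hausdorff_space X"

text \<open>Points of a product over \<open>\<Gamma>\<close> are extensional functions, hence the restriction of the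
  indicator functions to \<open>\<Gamma>\<close>. The condition \<open>finite A\<close> is needed because \<open>card\<close> of an infinite
  set is \<open>0\<close>.\<close>

definition sigma_space :: "nat \<Rightarrow> 'g set \<Rightarrow> ('g \<Rightarrow> nat) topology" where
  "sigma_space n \<Gamma> =
     subtopology (product_topology (\<lambda>_. discrete_topology {0, 1}) \<Gamma>)
       {restrict (indicator A) \<Gamma> | A. A \<subseteq> \<Gamma> \<and> finite A \<and> card A \<le> n}"

text \<open>The class \<open>EC\<^sub>n\<close> allows an arbitrary index set \<open>\<Gamma>\<close>. Since one cannot quantify over types
  inside a definition, the elements of \<open>\<Gamma>\<close> are taken here from the type of sets of points of \<open>K\<close>;
  lemma \<open>EC_if_embedding\<close> below shows that index sets of any other type give nothing more.\<close>

definition EC :: "nat \<Rightarrow> 'a topology \<Rightarrow> bool" where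
  "EC n K \<longleftrightarrow> compact_space K \<and>
     (\<exists>(\<Gamma> :: 'a set set) f. embedding_map K (sigma_space n \<Gamma>) f)"

lemma Hausdorff_sigma_space: "Hausdorff_space (sigma_space n \<Gamma>)"
  unfolding sigma_space_def
  by (intro Hausdorff_space_subtopology)
     (simp add: Hausdorff_space_product_topology Hausdorff_space_discrete_topology)

lemma topspace_sigma_space:
  "topspace (sigma_space n \<Gamma>) = {restrict (indicator A) \<Gamma> | A. A \<subseteq> \<Gamma> \<and> finite A \<and> card A \<le> n}"
  unfolding sigma_space_def by (auto simp: PiE_iff indicator_def)

lemma EC_if_embedding:
  fixes K :: "'a topology" and \<Gamma> :: "'g set"
  assumes K: "compact_space K" and f: "embedding_map K (sigma_space n \<Gamma>) f"
  shows "EC n K"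
proof -
  define U where "U \<gamma> = {x \<in> topspace K. f x \<gamma> = 1}" for \<gamma>
  define G where "G = U ` \<Gamma>"
  define g :: "'a \<Rightarrow> 'a set \<Rightarrow> nat" where "g x = restrict (indicator {V \<in> G. x \<in> V}) G" for x
  have cf: "continuous_map K (sigma_space n \<Gamma>) f"
    using f by (meson continuous_map_in_subtopology embedding_map_def homeomorphic_imp_continuous_map)
  then have cp: "continuous_map K (product_topology (\<lambda>_. discrete_topology {0, 1}) \<Gamma>) f"
    unfolding sigma_space_def by (simp add: continuous_map_in_subtopology)
  have inj: "inj_on f (topspace K)"
    using f unfolding embedding_map_def by (metis homeomorphic_imp_injective_map)
  have ex: "\<exists>A. f x = restrict (indicator A) \<Gamma> \<and> A \<subseteq> \<Gamma> \<and> finite A \<and> card A \<le> n" if "x \<in> topspace K" for x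
    using continuous_map_image_subset_topspace[OF cf] that unfolding topspace_sigma_space by blast
  have comp: "continuous_map K (discrete_topology {0, 1}) (\<lambda>x. f x \<gamma>)" if "\<gamma> \<in> \<Gamma>" for \<gamma>
    using cp that by (simp add: continuous_map_componentwise)
  have mem: "g x \<in> topspace (sigma_space n G)" if x: "x \<in> topspace K" for x
  proof -
    obtain A where A: "f x = restrict (indicator A) \<Gamma>" "A \<subseteq> \<Gamma>" "finite A" "card A \<le> n"
      using ex[OF x] by blast
    have sub: "{V \<in> G. x \<in> V} \<subseteq> U ` A"
    proof
      fix V assume "V \<in> {V \<in> G. x \<in> V}"
      then obtain \<gamma> where \<gamma>: "\<gamma> \<in> \<Gamma>" "V = U \<gamma>" "f x \<gamma> = 1"
        by (auto simp: G_def U_def)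
      then have "\<gamma> \<in> A"
        using A(1) by (cases "\<gamma> \<in> A") auto
      then show "V \<in> U ` A" using \<gamma>(2) by blast
    qed
    have "finite {V \<in> G. x \<in> V}" using sub A(3) finite_surj by blast
    moreover have "card {V \<in> G. x \<in> V} \<le> n"
      using surj_card_le[OF A(3) sub] A(4) by linarith
    ultimately show ?thesis
      unfolding topspace_sigma_space g_def by blast
  qed
  have cg: "continuous_map K (discrete_topology {0, 1}) (\<lambda>x. g x V)" if V: "V \<in> G" for V
  proof -
    obtain \<gamma> where \<gamma>: "\<gamma> \<in> \<Gamma>" "V = U \<gamma>" using V by (auto simp: G_def)
    have "f x \<gamma> = g x V" if "x \<in> topspace K" for x
      using ex[OF that] V \<gamma> that by (auto simp: g_def U_def indicator_def)
    then show ?thesis using comp[OF \<gamma>(1)] by (rule continuous_map_eq[rotated])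
  qed
  have contg: "continuous_map K (sigma_space n G) g"
    unfolding sigma_space_def continuous_map_in_subtopology
    using cg mem[unfolded topspace_sigma_space]
    by (auto simp: continuous_map_componentwise g_def)
  have injg: "inj_on g (topspace K)"
  proof (rule inj_onI)
    fix x y assume xy: "x \<in> topspace K" "y \<in> topspace K" "g x = g y"
    have iff: "f x \<gamma> = 1 \<longleftrightarrow> f y \<gamma> = 1" if "\<gamma> \<in> \<Gamma>" for \<gamma>
    proof -
      have "U \<gamma> \<in> G" using that by (simp add: G_def)
      then have "x \<in> U \<gamma> \<longleftrightarrow> y \<in> U \<gamma>"
        using fun_cong[OF xy(3), of "U \<gamma>"]
        by (cases "x \<in> U \<gamma>"; cases "y \<in> U \<gamma>") (simp_all add: g_def)
      then show ?thesis using xy by (simp add: U_def)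
    qed
    have "f x = f y"
    proof
      fix \<gamma>
      show "f x \<gamma> = f y \<gamma>"
        using ex[OF xy(1)] ex[OF xy(2)] iff[of \<gamma>]
        by (cases "\<gamma> \<in> \<Gamma>") (auto simp: indicator_def of_bool_def split: if_splits)
    qed
    then show "x = y" using inj xy by (auto dest: inj_onD)
  qed
  have "embedding_map K (sigma_space n G) g"
    using contg injg K
    by (meson Hausdorff_sigma_space T1_Spaces.continuous_imp_closed_map injective_closed_imp_embedding_map)
  then show ?thesis unfolding EC_def using K by blast
qed

lemma EC_imp_tikhonov_space:
  assumes "EC n K" shows "tikhonov_space K"
proof -
  obtain \<Gamma> :: "'a set set" and f where f: "embedding_map K (sigma_space n \<Gamma>) f"
    and K: "compact_space K" using assms unfolding EC_def by blast
  have "Hausdorff_space (subtopology (sigma_space n \<Gamma>) (f ` topspace K))"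
    by (simp add: Hausdorff_sigma_space Hausdorff_space_subtopology)
  then have "Hausdorff_space K"
    using f embedding_map_imp_homeomorphic_space homeomorphic_Hausdorff_space by blast
  then show ?thesis
    using K unfolding tikhonov_space_def
    by (simp add: compact_Hausdorff_or_regular_imp_normal_space Hausdorff_imp_t1_space
        normal_imp_completely_regular_space)
qed

end

theory Submission
  imports Defs
begin

text \<open>
  A compact Hausdorff space belongs to \<open>EC\<^sub>n\<close> as soon as it has a point-separating family of clopen
  sets that covers every point at most \<open>n\<close> times, so such a family with \<open>n = 3\<close> is built on \<open>L\<close>.

  View the points of \<open>K\<close> as sets \<open>s x\<close> of size at most two. A pair is isolated in \<open>K\<close>. Since \<open>f\<close> is a
  closed map, a point of \<open>L\<close> whose fibre consists of pairs only is isolated in \<open>L\<close>; let \<open>I\<close> be the set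
  of these points, and let \<open>D\<close> be the set of points whose fibre contains a singleton but not the empty
  set. At most one point of \<open>L\<close>, the image of the empty set, lies outside \<open>D \<union> I\<close>.

  For \<open>d \<in> D\<close> let \<open>S d\<close> be the set of all \<open>\<gamma>\<close> with \<open>{\<gamma>}\<close> in the fibre of \<open>d\<close>. The points of \<open>K\<close> that meet
  \<open>S d\<close>, together with the pairs in the fibre of \<open>d\<close>, form an open neighbourhood of that fibre. It
  contains no singleton outside the fibre, so it yields a neighbourhood of \<open>d\<close> whose points other than
  \<open>d\<close> all belong to \<open>I\<close>, and inside it there is a clopen neighbourhood \<open>U d\<close>
  (\<open>clopen_neighbourhood_if_rest_isolated\<close>). If \<open>p \<noteq> d\<close> is in \<open>U d\<close>, then every point of the fibre of
  \<open>p\<close> meets \<open>S d\<close>. The sets \<open>S d\<close> are pairwise disjoint and a point of \<open>K\<close> has at most two elements, so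
  \<open>p\<close> lies in at most two of the sets \<open>U d\<close>. The sets \<open>U d\<close> for \<open>d \<in> D\<close> and \<open>{p}\<close> for \<open>p \<in> I\<close> therefore
  cover each point at most three times. They separate points: \<open>{p}\<close> tells \<open>p\<close> from every other point,
  and \<open>U d\<close> tells \<open>d\<close> from the rest of \<open>D\<close> and from the image of the empty set, since all its points
  other than \<open>d\<close> are in \<open>I\<close>.
\<close>

section \<open>Set-valued codings of spaces in the classes EC\<close>

lemma EC_obtain_set_coding:
  fixes K :: "'a topology"
  assumes "EC n K"
  obtains s :: "'a \<Rightarrow> 'a set set"
  where "inj_on s (topspace K)"
    and "\<And>x. x \<in> topspace K \<Longrightarrow> finite (s x)"
    and "\<And>x. x \<in> topspace K \<Longrightarrow> card (s x) \<le> n"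
    and "\<And>\<gamma>. openin K {x \<in> topspace K. \<gamma> \<in> s x}"
proof -
  obtain \<Gamma> :: "'a set set" and h where h: "embedding_map K (sigma_space n \<Gamma>) h"
    using assms unfolding EC_def by blast
  define s where "s x = {\<gamma> \<in> \<Gamma>. h x \<gamma> = 1}" for x
  have ch: "continuous_map K (sigma_space n \<Gamma>) h"
    using h by (meson continuous_map_in_subtopology embedding_map_def homeomorphic_imp_continuous_map)
  have inj: "inj_on h (topspace K)"
    using h unfolding embedding_map_def by (metis homeomorphic_imp_injective_map)
  have comp: "continuous_map K (discrete_topology {0, 1}) (\<lambda>x. h x \<gamma>)" if "\<gamma> \<in> \<Gamma>" for \<gamma>
    using ch that unfolding sigma_space_def
    by (simp add: continuous_map_in_subtopology continuous_map_componentwise)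
  have code: "h x = restrict (indicator (s x)) \<Gamma> \<and> finite (s x) \<and> card (s x) \<le> n"
    if "x \<in> topspace K" for x
  proof -
    have "h x \<in> topspace (sigma_space n \<Gamma>)"
      using continuous_map_image_subset_topspace[OF ch] that by blast
    then obtain A where A: "h x = restrict (indicator A) \<Gamma>" "A \<subseteq> \<Gamma>" "finite A" "card A \<le> n"
      by (auto simp: topspace_sigma_space)
    have "h x \<gamma> = 1 \<longleftrightarrow> \<gamma> \<in> A" if "\<gamma> \<in> \<Gamma>" for \<gamma>
      using that by (simp add: A(1) indicator_def)
    then have "s x = A"
      using A(2) by (auto simp: s_def)
    with A show ?thesis by simp
  qed
  show thesis
  proof (rule that[of s])
    show "inj_on s (topspace K)"
    proof (rule inj_onI)
      fix x y assume xy: "x \<in> topspace K" "y \<in> topspace K" "s x = s y"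
      then have "h x = h y" using code[OF xy(1)] code[OF xy(2)] by argo
      then show "x = y" using inj_onD[OF inj] xy(1,2) by blast
    qed
    fix \<gamma>
    show "openin K {x \<in> topspace K. \<gamma> \<in> s x}"
    proof (cases "\<gamma> \<in> \<Gamma>")
      case True
      then show ?thesis
        using openin_continuous_map_preimage[OF comp[OF True], of "{1}"] True
        by (simp add: s_def)
    qed (simp add: s_def)
  qed (use code in auto)
qed

text \<open>The trace of a point on the family is the required coding by finite sets; compactness makes the
  resulting continuous injection an embedding.\<close>

lemma EC_if_separating_clopen_family:
  fixes L :: "'b topology" and G :: "'b set set"
  assumes L: "compact_space L"
    and clopen: "\<And>V. V \<in> G \<Longrightarrow> openin L V \<and> closedin L V"
    and order: "\<And>y. y \<in> topspace L \<Longrightarrow> finite {V \<in> G. y \<in> V} \<and> card {V \<in> G. y \<in> V} \<le> n"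
    and separating: "\<And>y z. y \<in> topspace L \<Longrightarrow> z \<in> topspace L \<Longrightarrow> y \<noteq> z \<Longrightarrow> \<exists>V\<in>G. y \<in> V \<longleftrightarrow> z \<notin> V"
  shows "EC n L"
proof -
  define g :: "'b \<Rightarrow> 'b set \<Rightarrow> nat" where "g y = restrict (indicator {V \<in> G. y \<in> V}) G" for y
  have mem: "g y \<in> topspace (sigma_space n G)" if "y \<in> topspace L" for y
    using order[OF that] unfolding topspace_sigma_space g_def by blast
  have cg: "continuous_map L (discrete_topology {0, 1}) (\<lambda>y. g y V)" if V: "V \<in> G" for V
  proof -
    have "openin L {y \<in> topspace L. g y V \<in> W}" if "W \<subseteq> {0, 1}" for W
    proof -
      have VL: "V \<subseteq> topspace L" using clopen[OF V] openin_subset by blast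
      have "{y \<in> topspace L. g y V \<in> W} =
          (if 1 \<in> W then V else {}) \<union> (if 0 \<in> W then topspace L - V else {})"
        using V VL by (auto simp: g_def indicator_def of_bool_def split: if_splits)
      then show ?thesis using clopen[OF V] by (simp add: openin_Un openin_diff)
    qed
    then show ?thesis
      using V by (auto simp: continuous_map_def g_def indicator_def)
  qed
  have contg: "continuous_map L (sigma_space n G) g"
    unfolding sigma_space_def continuous_map_in_subtopology
    using cg mem[unfolded topspace_sigma_space]
    by (auto simp: continuous_map_componentwise g_def)
  have injg: "inj_on g (topspace L)"
  proof (rule inj_onI, rule ccontr)
    fix y z assume yz: "y \<in> topspace L" "z \<in> topspace L" "g y = g z" "y \<noteq> z"
    then obtain V where V: "V \<in> G" "y \<in> V \<longleftrightarrow> z \<notin> V" using separating by blast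
    then show False
      using fun_cong[OF yz(3), of V] by (auto simp: g_def indicator_def)
  qed
  have "embedding_map L (sigma_space n G) g"
    using contg injg L
    by (meson Hausdorff_sigma_space continuous_imp_closed_map injective_closed_imp_embedding_map)
  then show ?thesis using L EC_if_embedding by blast
qed

text \<open>The finitely many basic open sets given by the elements of \<open>s x\<close> meet in the points whose code
  contains \<open>s x\<close>; since \<open>s x\<close> has the largest possible size, only \<open>x\<close> itself is left.\<close>

lemma openin_singleton_if_code_maximal:
  assumes inj: "inj_on s (topspace K)"
    and fin: "\<And>x. x \<in> topspace K \<Longrightarrow> finite (s x)"
    and card: "\<And>x. x \<in> topspace K \<Longrightarrow> card (s x) \<le> n"
    and op: "\<And>\<gamma>. openin K {x \<in> topspace K. \<gamma> \<in> s x}"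
    and x: "x \<in> topspace K" "card (s x) = n"
  shows "openin K {x}"
proof -
  have "{x} = {y \<in> topspace K. s x \<subseteq> s y}"
  proof -
    have "y = x" if y: "y \<in> topspace K" "s x \<subseteq> s y" for y
    proof -
      have "s x = s y"
        using card_seteq[OF fin[OF y(1)] y(2)] card[OF y(1)] x(2) by simp
      then show ?thesis using inj x y by (auto dest: inj_onD)
    qed
    then show ?thesis using x by auto
  qed
  also have "\<dots> = topspace K \<inter> (\<Inter>\<gamma>\<in>s x. {y \<in> topspace K. \<gamma> \<in> s y})"
    by auto
  also have "openin K \<dots>"
    using fin[OF x(1)] op by (intro openin_Int_Inter) auto
  finally show ?thesis .
qed

section \<open>Neighbourhoods in the image\<close>

lemma openin_fibres_inside:
  assumes "closed_map K L f" "openin K W"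
  shows "openin L {y \<in> topspace L. \<forall>x\<in>topspace K. f x = y \<longrightarrow> x \<in> W}"
proof -
  have "closedin L (f ` (topspace K - W))"
    using assms by (auto simp: closed_map_def)
  moreover have "{y \<in> topspace L. \<forall>x\<in>topspace K. f x = y \<longrightarrow> x \<in> W}
      = topspace L - f ` (topspace K - W)"
    by auto
  ultimately show ?thesis by (simp add: openin_diff)
qed

text \<open>By regularity \<open>d\<close> has an open neighbourhood whose closure is still inside \<open>U\<close>. That closure is
  open: \<open>d\<close> is an interior point of it, and all its other points are isolated.\<close>

lemma clopen_neighbourhood_if_rest_isolated:
  assumes reg: "regular_space L" and U: "openin L U" "d \<in> U"
    and iso: "\<And>p. p \<in> U \<Longrightarrow> p \<noteq> d \<Longrightarrow> openin L {p}"
  obtains V where "openin L V" "closedin L V" "d \<in> V" "V \<subseteq> U"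
proof -
  have "neighbourhood_base_of (closedin L) L"
    using reg by (simp add: neighbourhood_base_of_closedin)
  then obtain A V where V: "openin L A" "closedin L V" "d \<in> A" "A \<subseteq> V" "V \<subseteq> U"
    using U by (metis neighbourhood_base_of)
  have "openin L (A \<union> \<Union>((\<lambda>p. {p}) ` (V - {d})))"
    using V iso by (intro openin_Un openin_Union) auto
  moreover have "A \<union> \<Union>((\<lambda>p. {p}) ` (V - {d})) = V"
    using V by auto
  ultimately have "openin L V" by simp
  with V that show thesis by blast
qed

section \<open>Continuous images\<close>

theorem theorem3p5:
  fixes K :: "'a topology" and L :: "'b topology" and f :: "'a \<Rightarrow> 'b"
  assumes "EC 2 K"
    and "tikhonov_space L"
    and "continuous_map K L f"
    and "f ` topspace K = topspace L"
  shows "EC 3 L"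
proof -
  obtain s :: "'a \<Rightarrow> 'a set set" where inj: "inj_on s (topspace K)"
    and fin: "\<And>x. x \<in> topspace K \<Longrightarrow> finite (s x)"
    and card: "\<And>x. x \<in> topspace K \<Longrightarrow> card (s x) \<le> 2"
    and op: "\<And>\<gamma>. openin K {x \<in> topspace K. \<gamma> \<in> s x}"
    using EC_obtain_set_coding[OF assms(1)] by metis
  have K: "compact_space K" using assms(1) by (simp add: EC_def)
  have haus: "Hausdorff_space L" using assms(2) by (simp add: tikhonov_space_def)
  have L: "compact_space L"
    using image_compactin[OF _ assms(3), of "topspace K"] K assms(4) by (simp add: compact_space_def)
  have reg: "regular_space L"
    using L haus by (simp add: compact_Hausdorff_imp_regular_space)
  have closed: "closed_map K L f"
    using K haus assms(3) by (simp add: T1_Spaces.continuous_imp_closed_map)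
  have fibre: "\<exists>x\<in>topspace K. f x = y" if "y \<in> topspace L" for y
    using that assms(4) by (metis imageE)
  have same: "x = y" if "x \<in> topspace K" "y \<in> topspace K" "s x = s y" for x y
    using inj_onD[OF inj] that by blast
  note pair_open = openin_singleton_if_code_maximal[OF inj fin card op]

  define I where "I = {y \<in> topspace L. \<forall>x\<in>topspace K. f x = y \<longrightarrow> card (s x) = 2}"
  define D where "D = {y \<in> topspace L. (\<forall>x\<in>topspace K. f x = y \<longrightarrow> s x \<noteq> {})} - I"
  define S where "S d = {\<gamma>. \<exists>x\<in>topspace K. s x = {\<gamma>} \<and> f x = d}" for d
  define P where "P = {x \<in> topspace K. card (s x) = 2}"

  have card_cases: "s x = {} \<or> (\<exists>\<gamma>. s x = {\<gamma>}) \<or> x \<in> P" if "x \<in> topspace K" for x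
  proof -
    have "card (s x) = 0 \<or> card (s x) = 1 \<or> card (s x) = 2" using card[OF that] by linarith
    then show ?thesis using fin[OF that] that by (auto simp: P_def card_1_singleton_iff)
  qed
  have openP: "openin K A" if "A \<subseteq> P" for A
  proof -
    have "openin K (\<Union>x\<in>A. {x})"
      using that pair_open by (intro openin_Union) (auto simp: P_def)
    then show ?thesis by simp
  qed
  have I_open: "openin L {p}" if "p \<in> I" for p
  proof -
    have "openin L {y \<in> topspace L. \<forall>x\<in>topspace K. f x = y \<longrightarrow> x \<in> {x \<in> topspace K. f x = p}}"
      using that by (intro openin_fibres_inside[OF closed] openP) (auto simp: I_def P_def)
    also have "{y \<in> topspace L. \<forall>x\<in>topspace K. f x = y \<longrightarrow> x \<in> {x \<in> topspace K. f x = p}} = {p}"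
      using that fibre by (auto simp: I_def)
    finally show ?thesis .
  qed

  have "\<exists>V. openin L V \<and> closedin L V \<and> d \<in> V \<and> (\<forall>p\<in>V. p \<noteq> d \<longrightarrow> p \<in> I) \<and>
      (\<forall>x\<in>topspace K. f x \<in> V \<longrightarrow> f x \<noteq> d \<longrightarrow> s x \<inter> S d \<noteq> {})" if d: "d \<in> D" for d
  proof -
    define W where "W = (\<Union>\<gamma>\<in>S d. {x \<in> topspace K. \<gamma> \<in> s x}) \<union> {x \<in> P. f x = d}"
    define N where "N = {y \<in> topspace L. \<forall>x\<in>topspace K. f x = y \<longrightarrow> x \<in> W}"
    have "openin K W"
      unfolding W_def using op openP[of "{x \<in> P. f x = d}"] by (intro openin_Un openin_Union) auto
    then have N: "openin L N"
      unfolding N_def by (rule openin_fibres_inside[OF closed])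
    have "x \<in> W" if "x \<in> topspace K" "f x = d" for x
      using card_cases[OF that(1)] d that by (auto simp: W_def D_def S_def)
    then have dN: "d \<in> N" using d by (auto simp: N_def D_def)
    have meets: "s x \<inter> S d \<noteq> {}" if "x \<in> topspace K" "f x \<in> N" "f x \<noteq> d" for x
      using that by (auto simp: N_def W_def)
    have NI: "p \<in> I" if p: "p \<in> N" "p \<noteq> d" for p
    proof -
      have "card (s x) = 2" if x: "x \<in> topspace K" "f x = p" for x
      proof -
        obtain \<gamma> where \<gamma>: "\<gamma> \<in> s x" "\<gamma> \<in> S d" using meets[OF x(1)] x(2) p by blast
        \<comment> \<open>If \<open>s x\<close> were the singleton of \<open>\<gamma>\<close>, \<open>x\<close> would be the point that puts \<open>\<gamma>\<close> into \<open>S d\<close>, and \<open>p = d\<close>.\<close>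
        have "s x \<noteq> {\<gamma>}"
          using \<gamma>(2) same x p(2) by (force simp: S_def)
        then show ?thesis using card_cases[OF x(1)] \<gamma>(1) by (auto simp: P_def)
      qed
      then show ?thesis using p by (auto simp: I_def N_def)
    qed
    obtain V where "openin L V" "closedin L V" "d \<in> V" "V \<subseteq> N"
      using clopen_neighbourhood_if_rest_isolated[OF reg N dN] NI I_open by blast
    with NI meets show ?thesis by blast
  qed
  then obtain U where U: "\<And>d. d \<in> D \<Longrightarrow> openin L (U d) \<and> closedin L (U d) \<and> d \<in> U d"
    and UI: "\<And>d p. d \<in> D \<Longrightarrow> p \<in> U d \<Longrightarrow> p \<noteq> d \<Longrightarrow> p \<in> I"
    and meets: "\<And>d x. d \<in> D \<Longrightarrow> x \<in> topspace K \<Longrightarrow> f x \<in> U d \<Longrightarrow> f x \<noteq> d \<Longrightarrow> s x \<inter> S d \<noteq> {}"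
    by metis
  have disj: "D \<inter> I = {}" by (auto simp: D_def)

  define G where "G = U ` D \<union> (\<lambda>p. {p}) ` I"
  show ?thesis
  proof (rule EC_if_separating_clopen_family[OF L, of G])
    fix V assume "V \<in> G"
    then show "openin L V \<and> closedin L V"
      using U I_open haus
      by (auto simp: G_def I_def Hausdorff_imp_t1_space closedin_t1_singleton)
  next
    fix y assume y: "y \<in> topspace L"
    consider "y \<in> I" | "y \<in> D" | "y \<notin> I" "y \<notin> D" by blast
    then show "finite {V \<in> G. y \<in> V} \<and> card {V \<in> G. y \<in> V} \<le> 3"
    proof cases
      case 1
      obtain x where x: "x \<in> topspace K" "f x = y" using fibre[OF y] by blast
      \<comment> \<open>\<open>e\<close> sends an element of \<open>S d\<close> back to \<open>d\<close>; this is where disjointness of the \<open>S d\<close> enters.\<close>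
      define e where "e \<gamma> = f (inv_into (topspace K) s {\<gamma>})" for \<gamma>
      have "{d \<in> D. y \<in> U d} \<subseteq> e ` s x"
      proof
        fix d assume d: "d \<in> {d \<in> D. y \<in> U d}"
        then have dD: "d \<in> D" "y \<in> U d" by auto
        then have "f x \<noteq> d" using 1 disj x(2) by auto
        with meets[OF dD(1) x(1)] dD(2) x(2) have "s x \<inter> S d \<noteq> {}"
          by simp
        then obtain \<gamma> z where \<gamma>: "\<gamma> \<in> s x" "z \<in> topspace K" "s z = {\<gamma>}" "f z = d"
          unfolding S_def by blast
        then have "e \<gamma> = d" unfolding e_def using inv_into_f_f[OF inj \<gamma>(2)] by simp
        then show "d \<in> e ` s x" using \<gamma>(1) by blast
      qed
      then have sub: "{V \<in> G. y \<in> V} \<subseteq> insert {y} (U ` e ` s x)"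
        by (auto simp: G_def)
      have "card (U ` e ` s x) \<le> 2"
        using card[OF x(1)] card_image_le[OF fin[OF x(1)], of "\<lambda>\<gamma>. U (e \<gamma>)"]
        by (simp add: image_image)
      then have "card (insert {y} (U ` e ` s x)) \<le> 3"
        using fin[OF x(1)] by (simp add: card_insert_if)
      moreover have "finite (insert {y} (U ` e ` s x))" using fin[OF x(1)] by simp
      ultimately show ?thesis using sub by (meson card_mono finite_subset order_trans)
    next
      case 2
      then have sub: "{V \<in> G. y \<in> V} \<subseteq> {U y}"
        using UI disj by (auto simp: G_def)
      then have "finite {V \<in> G. y \<in> V}"
        using finite_subset by blast
      with card_mono[OF _ sub] show ?thesis by simp
    next
      case 3
      then have none: "{V \<in> G. y \<in> V} = {}"
        using UI by (auto simp: G_def)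
      show ?thesis unfolding none by simp
    qed
  next
    fix y z assume yz: "y \<in> topspace L" "z \<in> topspace L" "y \<noteq> z"
    have "\<exists>x\<in>topspace K. f x = a \<and> s x = {}" if "a \<in> topspace L" "a \<notin> D \<union> I" for a
      using that by (auto simp: D_def)
    then have "y \<in> D \<union> I \<or> z \<in> D \<union> I"
      using yz same by metis
    moreover have "\<exists>V\<in>G. a \<in> V \<longleftrightarrow> b \<notin> V" if "a \<in> D \<union> I" "a \<noteq> b" for a b
    proof (cases "a \<in> I \<or> b \<in> I")
      case True
      then have "{a} \<in> G \<or> {b} \<in> G" unfolding G_def by blast
      moreover have "a \<in> {a} \<longleftrightarrow> b \<notin> {a}" "a \<in> {b} \<longleftrightarrow> b \<notin> {b}"
        using that(2) by simp_all
      ultimately show ?thesis by meson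
    next
      case False
      then have a: "a \<in> D" using that(1) by simp
      have "b \<notin> U a" using UI[OF a] False that(2) by metis
      moreover have "a \<in> U a" "U a \<in> G" using U[OF a] a by (simp_all add: G_def)
      ultimately show ?thesis by meson
    qed
    ultimately show "\<exists>V\<in>G. y \<in> V \<longleftrightarrow> z \<notin> V"
      using yz(3) by metis
  qed
qed

end
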